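(* Let $X$ be a compact metric space, $T:X\to X$ a continuous map (viewed as a $\mathbb{Z}_+$-action), and $Z\subset X$. Then: (i) $h^S_{top}(T,Z)\geq h^B_{top}(T,Z)$; (ii) if $h^B_{top}(T,Z)>0$, then $h^S_{top}(T,Z)=+\infty$.
   Context: Let $(X,\rho)$ be a compact metric space and $T:X\to X$ continuous. For $n\in\mathbb{N}$, $x\in X$, $\epsilon>0$ let $B_n(x,\epsilon)=\{y\in X:\max_{0\le j<n}\rho(T^jx,T^jy)<\epsilon\}$. Topological slow entropy: for $Z\subset X$, $s\ge0$, $N\in\mathbb{N}$, $\epsilon>0$ let $M(Z,s,N,\epsilon)=\inf\sum_i(1/n_i)^s$, the infimum over all finite or countable families $\{B_{n_i}(x_i,\epsilon)\}$ with $x_i\in X$, $n_i\ge N$ and $\bigcup_iB_{n_i}(x_i,\epsilon)\supset Z$. Let $M(Z,s,\epsilon)=\lim_{N\to\infty}M(Z,s,N,\epsilon)$, $h^S_{top}(T,Z,\epsilon)=\inf\{s\ge0:M(Z,s,\epsilon)=0\}=\sup\{s\ge0:M(Z,s,\epsilon)=\infty\}$ (with $\inf\emptyset=+\infty$, $\sup\emptyset=0$), and $h^S_{top}(T,Z)=\lim_{\epsilon\to0}h^S_{top}(T,Z,\epsilon)$. Bowen topological entropy $h^B_{top}(T,Z)$ is defined in exactly the same way with $(1/n_i)^s$ replaced by $e^{-n_is}$: $M^B(Z,s,N,\epsilon)=\inf\sum_ie^{-n_is}$ over the same families, $M^B(Z,s,\epsilon)=\lim_{N\to\infty}M^B(Z,s,N,\epsilon)$,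 $h^B_{top}(T,Z,\epsilon)=\inf\{s\ge0:M^B(Z,s,\epsilon)=0\}=\sup\{s\ge0:M^B(Z,s,\epsilon)=\infty\}$, and $h^B_{top}(T,Z)=\lim_{\epsilon\to0}h^B_{top}(T,Z,\epsilon)$. *)

theory Defs
  imports "HOL-Analysis.Analysis"
begin

text \<open>
  A compact dynamical system is given by a compact set \<open>X\<close> in a metric space and a map
  \<open>T\<close> with \<open>T ` X \<subseteq> X\<close>; only the values of \<open>T\<close> on \<open>X\<close> matter below.
\<close>

text \<open>The maximum is over a nonempty set only for \<open>n \<ge> 1\<close>; no other \<open>n\<close> is used below.\<close>

definition bowen_ball :: "'a::metric_space set \<Rightarrow> ('a \<Rightarrow> 'a) \<Rightarrow> nat \<Rightarrow> 'a \<Rightarrow> real \<Rightarrow> 'a set" where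
  "bowen_ball X T n x \<epsilon> =
     {y \<in> X. Max ((\<lambda>j. dist ((T ^^ j) x) ((T ^^ j) y)) ` {..<n}) < \<epsilon>}"

text \<open>
  A finite or countable family of Bowen balls is indexed by a set \<open>I\<close> of natural numbers.
  Orders \<open>n i = 0\<close> are excluded, which only affects the value at \<open>N = 0\<close>.
\<close>

definition bowen_cover ::
    "'a::metric_space set \<Rightarrow> ('a \<Rightarrow> 'a) \<Rightarrow> 'a set \<Rightarrow> nat \<Rightarrow> real
       \<Rightarrow> nat set \<Rightarrow> (nat \<Rightarrow> 'a) \<Rightarrow> (nat \<Rightarrow> nat) \<Rightarrow> bool" where
  "bowen_cover X T Z N \<epsilon> I x n \<longleftrightarrow>
     (\<forall>i\<in>I. x i \<in> X \<and> n i \<ge> 1 \<and> n i \<ge> N) \<and> Z \<subseteq> (\<Union>i\<in>I. bowen_ball X T (n i) (x i) \<epsilon>)"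

text \<open>
  The slow entropy and the Bowen entropy come from the same construction, applied to the
  weights \<open>w n s = (1/n)\<^sup>s\<close> and \<open>w n s = e\<^sup>-\<^sup>n\<^sup>s\<close> respectively.
\<close>

definition cover_M_at ::
    "(nat \<Rightarrow> real \<Rightarrow> real) \<Rightarrow> 'a::metric_space set \<Rightarrow> ('a \<Rightarrow> 'a) \<Rightarrow> 'a set
       \<Rightarrow> real \<Rightarrow> nat \<Rightarrow> real \<Rightarrow> ennreal" where
  "cover_M_at w X T Z s N \<epsilon> =
     Inf {(\<Sum>\<^sub>\<infinity>i\<in>I. ennreal (w (n i) s)) | I x n. bowen_cover X T Z N \<epsilon> I x n}"

definition cover_M ::
    "(nat \<Rightarrow> real \<Rightarrow> real) \<Rightarrow> 'a::metric_space set \<Rightarrow> ('a \<Rightarrow> 'a) \<Rightarrow> 'a set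
       \<Rightarrow> real \<Rightarrow> real \<Rightarrow> ennreal" where
  "cover_M w X T Z s \<epsilon> = lim (\<lambda>N. cover_M_at w X T Z s N \<epsilon>)"

definition cover_entropy_at ::
    "(nat \<Rightarrow> real \<Rightarrow> real) \<Rightarrow> 'a::metric_space set \<Rightarrow> ('a \<Rightarrow> 'a) \<Rightarrow> 'a set \<Rightarrow> real \<Rightarrow> ennreal" where
  "cover_entropy_at w X T Z \<epsilon> = Inf {ennreal s | s. s \<ge> 0 \<and> cover_M w X T Z s \<epsilon> = 0}"

definition cover_entropy ::
    "(nat \<Rightarrow> real \<Rightarrow> real) \<Rightarrow> 'a::metric_space set \<Rightarrow> ('a \<Rightarrow> 'a) \<Rightarrow> 'a set \<Rightarrow> ennreal" where
  "cover_entropy w X T Z = Lim (at_right 0) (\<lambda>\<epsilon>. cover_entropy_at w X T Z \<epsilon>)"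

definition slow_weight :: "nat \<Rightarrow> real \<Rightarrow> real" where
  "slow_weight n s = (1 / real n) powr s"

definition bowen_weight :: "nat \<Rightarrow> real \<Rightarrow> real" where
  "bowen_weight n s = exp (- (real n * s))"

definition top_slow_entropy ::
    "'a::metric_space set \<Rightarrow> ('a \<Rightarrow> 'a) \<Rightarrow> 'a set \<Rightarrow> ennreal" where
  "top_slow_entropy X T Z = cover_entropy slow_weight X T Z"

definition bowen_top_entropy ::
    "'a::metric_space set \<Rightarrow> ('a \<Rightarrow> 'a) \<Rightarrow> 'a set \<Rightarrow> ennreal" where
  "bowen_top_entropy X T Z = cover_entropy bowen_weight X T Z"


text \<open>
  Both limits above exist by monotonicity, so \<open>lim\<close> and \<open>Lim\<close> denote genuine limits.
\<close>

lemma cover_M_at_incseq: "incseq (\<lambda>N. cover_M_at w X T Z s N \<epsilon>)"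
proof (rule incseq_SucI)
  fix N
  have "bowen_cover X T Z N \<epsilon> I x n" if "bowen_cover X T Z (Suc N) \<epsilon> I x n" for I x n
    using that unfolding bowen_cover_def by (simp add: Suc_le_eq less_imp_le)
  then show "cover_M_at w X T Z s N \<epsilon> \<le> cover_M_at w X T Z s (Suc N) \<epsilon>"
    unfolding cover_M_at_def by (intro Inf_superset_mono) blast
qed

lemma cover_M_at_tendsto:
  "(\<lambda>N. cover_M_at w X T Z s N \<epsilon>) \<longlonglongrightarrow> cover_M w X T Z s \<epsilon>"
  unfolding cover_M_def using LIMSEQ_SUP[OF cover_M_at_incseq, of w X T Z s \<epsilon>]
  by (simp add: limI)

lemma cover_M_at_antimono_eps:
  assumes "\<epsilon> \<le> \<epsilon>'"
  shows "cover_M_at w X T Z s N \<epsilon>' \<le> cover_M_at w X T Z s N \<epsilon>"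
proof -
  have "bowen_ball X T k z \<epsilon> \<subseteq> bowen_ball X T k z \<epsilon>'" for k z
    unfolding bowen_ball_def using assms by (intro Collect_mono) (auto intro: less_le_trans)
  then have "bowen_cover X T Z N \<epsilon>' I x n" if "bowen_cover X T Z N \<epsilon> I x n" for I x n
    using that unfolding bowen_cover_def by blast
  then show ?thesis
    unfolding cover_M_at_def by (intro Inf_superset_mono) blast
qed

lemma cover_entropy_at_antimono:
  assumes "\<epsilon> \<le> \<epsilon>'"
  shows "cover_entropy_at w X T Z \<epsilon>' \<le> cover_entropy_at w X T Z \<epsilon>"
proof -
  have le: "cover_M w X T Z s \<epsilon>' \<le> cover_M w X T Z s \<epsilon>" for s
    by (rule LIMSEQ_le[OF cover_M_at_tendsto cover_M_at_tendsto])
       (use cover_M_at_antimono_eps[OF assms] in blast)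
  have "cover_M w X T Z s \<epsilon>' = 0" if "cover_M w X T Z s \<epsilon> = 0" for s
    using le[of s] that by simp
  then show ?thesis
    unfolding cover_entropy_at_def by (intro Inf_superset_mono) blast
qed

lemma cover_entropy_at_tendsto:
  "((\<lambda>\<epsilon>. cover_entropy_at w X T Z \<epsilon>) \<longlongrightarrow> cover_entropy w X T Z) (at_right 0)"
proof -
  let ?h = "\<lambda>\<epsilon>. cover_entropy_at w X T Z \<epsilon>"
  let ?S = "SUP \<epsilon>\<in>{0<..}. ?h \<epsilon>"
  have lim: "(?h \<longlongrightarrow> ?S) (at_right 0)"
  proof (rule order_tendstoI)
    fix a assume "a < ?S"
    then obtain e where e: "e > 0" "a < ?h e"
      by (auto simp: less_SUP_iff)
    have "a < ?h x" if "x < e" for x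
      using cover_entropy_at_antimono[of x e w X T Z] that e(2) by force
    then show "\<forall>\<^sub>F x in at_right 0. a < ?h x"
      using e(1) unfolding eventually_at_right_field by blast
  next
    fix a assume "?S < a"
    then have "?h x < a" if "x > 0" for x
      using that by (meson SUP_upper greaterThan_iff le_less_trans)
    then show "\<forall>\<^sub>F x in at_right 0. ?h x < a"
      unfolding eventually_at_right_field using zero_less_one by blast
  qed
  have "cover_entropy w X T Z = ?S"
    unfolding cover_entropy_def by (rule tendsto_Lim[OF _ lim]) simp
  then show ?thesis using lim by simp
qed

text \<open>The critical value is also the supremum of the \<open>s\<close> at which \<open>cover_M\<close> is infinite.\<close>

lemma infsum_ennreal_cmult:
  "(\<Sum>\<^sub>\<infinity>i\<in>I. c * f i) = c * (\<Sum>\<^sub>\<infinity>i\<in>I. f i)" for c :: ennreal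
  by (simp add: nonneg_infsum_complete SUP_mult_left_ennreal sum_distrib_left)

lemma cover_M_at_scale:
  assumes c: "c > 0"
    and w: "\<And>n. n \<ge> 1 \<Longrightarrow> n \<ge> N \<Longrightarrow> w n t \<le> c * w n s"
    and pos: "\<And>n. w n s \<ge> 0"
  shows "cover_M_at w X T Z t N \<epsilon> \<le> ennreal c * cover_M_at w X T Z s N \<epsilon>"
proof -
  have inv: "ennreal (1 / c) * (ennreal c * a) = a" "ennreal c * (ennreal (1 / c) * a) = a" for a
    using c by (simp_all add: mult.assoc[symmetric] ennreal_mult[symmetric])
  have le: "cover_M_at w X T Z t N \<epsilon> \<le> ennreal c * (\<Sum>\<^sub>\<infinity>i\<in>I. ennreal (w (n i) s))"
    if cov: "bowen_cover X T Z N \<epsilon> I x n" for I x n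
  proof -
    have "cover_M_at w X T Z t N \<epsilon> \<le> (\<Sum>\<^sub>\<infinity>i\<in>I. ennreal (w (n i) t))"
      unfolding cover_M_at_def using cov by (intro Inf_lower) blast
    also have "\<dots> \<le> (\<Sum>\<^sub>\<infinity>i\<in>I. ennreal c * ennreal (w (n i) s))"
    proof (rule infsum_mono)
      fix i assume "i \<in> I"
      then have "w (n i) t \<le> c * w (n i) s"
        using cov w unfolding bowen_cover_def by blast
      then show "ennreal (w (n i) t) \<le> ennreal c * ennreal (w (n i) s)"
        using c pos by (metis ennreal_leI ennreal_mult less_imp_le)
    qed (auto intro: nonneg_summable_on_complete)
    finally show ?thesis by (simp add: infsum_ennreal_cmult)
  qed
  have "ennreal (1 / c) * cover_M_at w X T Z t N \<epsilon> \<le> cover_M_at w X T Z s N \<epsilon>"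
    unfolding cover_M_at_def[of w X T Z s]
  proof (rule Inf_greatest, clarify)
    fix I x n assume "bowen_cover X T Z N \<epsilon> I x n"
    from mult_left_mono[OF le[OF this], of "ennreal (1 / c)"]
    show "ennreal (1 / c) * cover_M_at w X T Z t N \<epsilon> \<le> (\<Sum>\<^sub>\<infinity>i\<in>I. ennreal (w (n i) s))"
      by (simp add: inv)
  qed
  from mult_left_mono[OF this, of "ennreal c"] show ?thesis by (simp add: inv)
qed

lemma cover_entropy_at_eq_Sup:
  assumes pos: "\<And>n s. w n s \<ge> 0"
    and dec: "\<And>s t. 0 \<le> s \<Longrightarrow> s < t \<Longrightarrow>
      \<exists>c. c \<longlonglongrightarrow> 0 \<and> (\<forall>N. c N > 0 \<and> (\<forall>n\<ge>max 1 N. w n t \<le> c N * w n s))"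
  shows "cover_entropy_at w X T Z \<epsilon> = Sup {ennreal s | s. s \<ge> 0 \<and> cover_M w X T Z s \<epsilon> = \<infinity>}"
    (is "_ = Sup ?S")
proof -
  have zero: "cover_M w X T Z t \<epsilon> = 0"
    if st: "0 \<le> s" "s < t" and fin: "cover_M w X T Z s \<epsilon> \<noteq> \<infinity>" for s t
  proof -
    obtain c where c: "c \<longlonglongrightarrow> 0" "\<And>N. c N > 0"
      and cw: "\<And>N n. n \<ge> 1 \<Longrightarrow> n \<ge> N \<Longrightarrow> w n t \<le> c N * w n s"
      using dec[OF st] by (metis max.bounded_iff)
    have "(\<lambda>N. ennreal (c N)) \<longlonglongrightarrow> 0"
      using tendsto_ennrealI[OF c(1)] by simp
    then have "(\<lambda>N. ennreal (c N) * cover_M_at w X T Z s N \<epsilon>) \<longlonglongrightarrow> 0 * cover_M w X T Z s \<epsilon>"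
      using fin by (intro tendsto_mult_ennreal cover_M_at_tendsto) auto
    moreover have "cover_M_at w X T Z t N \<epsilon> \<le> ennreal (c N) * cover_M_at w X T Z s N \<epsilon>" for N
      using c(2) cw pos by (intro cover_M_at_scale) auto
    ultimately have "cover_M w X T Z t \<epsilon> \<le> 0 * cover_M w X T Z s \<epsilon>"
      by (intro LIMSEQ_le[OF cover_M_at_tendsto]) auto
    then show ?thesis by simp
  qed
  have "Sup ?S \<le> cover_entropy_at w X T Z \<epsilon>"
    unfolding cover_entropy_at_def
  proof (intro Sup_least Inf_greatest, clarify)
    fix s t :: real
    assume s: "0 \<le> s" "cover_M w X T Z s \<epsilon> = \<infinity>" and t: "0 \<le> t" "cover_M w X T Z t \<epsilon> = 0"
    then have "s \<le> t" using zero[of t s] by force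
    then show "ennreal s \<le> ennreal t" by (rule ennreal_leI)
  qed
  moreover have "\<not> Sup ?S < cover_entropy_at w X T Z \<epsilon>"
  proof
    assume "Sup ?S < cover_entropy_at w X T Z \<epsilon>"
    then obtain b where b: "Sup ?S < b" "b < cover_entropy_at w X T Z \<epsilon>" using dense by blast
    then obtain a where a: "Sup ?S < a" "a < b" using dense by blast
    obtain s t where st: "a = ennreal s" "b = ennreal t" "0 \<le> s" "0 \<le> t"
      using a(2) b(2) by (metis ennreal_cases top.not_eq_extremum order.strict_trans less_irrefl)
    have "cover_M w X T Z s \<epsilon> \<noteq> \<infinity>"
      using a(1) st(1,3) Sup_upper[of a ?S] by (fastforce simp: not_le[symmetric])
    moreover have "s < t" using a(2) st by (simp add: ennreal_less_iff)
    ultimately have "cover_M w X T Z t \<epsilon> = 0" using zero st(3) by blast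
    then have "cover_entropy_at w X T Z \<epsilon> \<le> b"
      unfolding cover_entropy_at_def using st by (intro Inf_lower) blast
    then show False using b(2) by simp
  qed
  ultimately show ?thesis by (simp add: less_le)
qed

lemma slow_entropy_at_eq_Sup:
  "cover_entropy_at slow_weight X T Z \<epsilon> =
     Sup {ennreal s | s. s \<ge> 0 \<and> cover_M slow_weight X T Z s \<epsilon> = \<infinity>}"
proof (rule cover_entropy_at_eq_Sup)
  fix s t :: real assume st: "0 \<le> s" "s < t"
  let ?c = "\<lambda>N. (1 / real (max 1 N)) powr (t - s)"
  have "(\<lambda>N. 1 / real (max 1 N)) \<longlonglongrightarrow> 0"
    by (rule Lim_transform_eventually[OF lim_1_over_n])
       (use eventually_gt_at_top[of 0] in eventually_elim, simp)
  then have "?c \<longlonglongrightarrow> 0"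
    using st by (intro tendsto_zero_powrI[where b = "t - s"]) auto
  moreover have "slow_weight n t \<le> ?c N * slow_weight n s" if "n \<ge> max 1 N" for n N
  proof -
    have "slow_weight n t = (1 / real n) powr (t - s) * slow_weight n s"
      by (simp add: slow_weight_def powr_add[symmetric])
    moreover have "(1 / real n) powr (t - s) \<le> ?c N"
      using that st by (intro powr_mono2 divide_left_mono) auto
    ultimately show ?thesis by (simp add: slow_weight_def mult_right_mono)
  qed
  ultimately show "\<exists>c. c \<longlonglongrightarrow> 0 \<and>
      (\<forall>N. c N > 0 \<and> (\<forall>n\<ge>max 1 N. slow_weight n t \<le> c N * slow_weight n s))"
    by (intro exI[of _ ?c]) auto
qed (simp add: slow_weight_def)

lemma bowen_entropy_at_eq_Sup:
  "cover_entropy_at bowen_weight X T Z \<epsilon> =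
     Sup {ennreal s | s. s \<ge> 0 \<and> cover_M bowen_weight X T Z s \<epsilon> = \<infinity>}"
proof (rule cover_entropy_at_eq_Sup)
  fix s t :: real assume st: "0 \<le> s" "s < t"
  let ?c = "\<lambda>N. exp (s - t) ^ N"
  have "?c \<longlonglongrightarrow> 0" using st by (intro LIMSEQ_power_zero) simp
  moreover have "bowen_weight n t \<le> ?c N * bowen_weight n s" if "n \<ge> N" for n N
  proof -
    have "real N * (t - s) \<le> real n * (t - s)"
      using that st by (intro mult_right_mono) auto
    then have "- (real n * t) \<le> real N * (s - t) + - (real n * s)"
      by (simp add: algebra_simps)
    then have "exp (- (real n * t)) \<le> exp (real N * (s - t)) * exp (- (real n * s))"
      unfolding exp_add[symmetric] by simp
    then show ?thesis
      unfolding bowen_weight_def exp_of_nat_mult .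
  qed
  ultimately show "\<exists>c. c \<longlonglongrightarrow> 0 \<and>
      (\<forall>N. c N > 0 \<and> (\<forall>n\<ge>max 1 N. bowen_weight n t \<le> c N * bowen_weight n s))"
    by (intro exI[of _ ?c]) auto
qed (simp add: bowen_weight_def)

end

theory Submission
  imports Defs
begin

text \<open>
  Exponential weights are negligible against polynomial ones: for \<open>s \<ge> 0\<close> and \<open>t > 0\<close> there is
  a constant \<open>c\<close> with \<open>e\<^sup>-\<^sup>n\<^sup>t \<le> c (1/n)\<^sup>s\<close> for every \<open>n \<ge> 1\<close>. Both entropies use the same
  covers, so if the slow sums vanish at a single exponent \<open>s\<close>, then the exponential sums vanish at
  every \<open>t > 0\<close>. Thus at each scale \<open>\<epsilon>\<close> there is a dichotomy: either no exponent makes the slow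
  sums vanish and the slow entropy is infinite, or the Bowen entropy is zero
  (\<open>slow_entropy_at_infinite_or_bowen_entropy_at_zero\<close>). Both claims are instances of this
  dichotomy once it passes to the limit \<open>\<epsilon> \<rightarrow> 0\<close>. It does because the entropy at scale \<open>\<epsilon>\<close> grows
  as \<open>\<epsilon>\<close> decreases: a scale with positive Bowen entropy makes the slow entropy infinite at that
  scale and hence in the limit.
\<close>

lemma bowen_weight_le_slow_weight:
  assumes "s \<ge> 0" and "t > 0"
  obtains c where "c > 0" and "\<And>n. n \<ge> 1 \<Longrightarrow> bowen_weight n t \<le> c * slow_weight n s"
proof
  \<comment> \<open>Raising \<open>a n \<le> e\<^sup>a\<^sup>n\<close> to the power \<open>s\<close> gives \<open>(a n)\<^sup>s \<le> e\<^sup>a\<^sup>s\<^sup>n\<close>. The choice of \<open>a\<close> keeps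
      \<open>a s \<le> t\<close>; the \<open>1\<close> in the denominator covers \<open>s = 0\<close>.\<close>
  define a where "a = t / (s + 1)"
  have a: "a > 0" "a * s \<le> t"
    using assms by (auto simp: a_def field_simps)
  show "a powr (- s) > 0"
    using a(1) by simp
  fix n :: nat assume n: "n \<ge> 1"
  have "a * real n \<le> exp (a * real n)"
    using exp_ge_add_one_self[of "a * real n"] by linarith
  then have "(a * real n) powr s \<le> exp (a * real n) powr s"
    using a(1) assms(1) by (intro powr_mono2) auto
  also have "\<dots> = exp (a * s * real n)"
    by (simp add: powr_def mult_ac)
  also have "\<dots> \<le> exp (real n * t)"
    using mult_right_mono[OF a(2), of "real n"] by (simp add: mult.commute)
  finally have "inverse (exp (real n * t)) \<le> inverse ((a * real n) powr s)"
    using a(1) n by (intro le_imp_inverse_le) auto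
  also have "\<dots> = a powr (- s) * (1 / real n) powr s"
    using a(1) n by (simp add: powr_mult powr_divide powr_minus field_simps)
  finally show "bowen_weight n t \<le> a powr (- s) * slow_weight n s"
    by (simp add: bowen_weight_def slow_weight_def exp_minus)
qed

text \<open>
  Vanishing of the cover sums passes between weights that differ by a bounded factor, because the
  covers do not depend on the weight.
\<close>

lemma cover_M_eq_0_weight_mono:
  assumes c: "c > 0"
    and w: "\<And>n. n \<ge> 1 \<Longrightarrow> w' n t \<le> c * w n s"
    and pos: "\<And>n. w n s \<ge> 0"
    and zero: "cover_M w X T Z s \<epsilon> = 0"
  shows "cover_M w' X T Z t \<epsilon> = 0"
proof -
  \<comment> \<open>The scaling estimate \<open>cover_M_at_scale\<close> compares two exponents of one weight. Since only
      the values of a weight at the exponent in question enter, the two weights fit into one: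
      \<open>w\<close> is stored at exponent \<open>0\<close> and \<open>w'\<close> at exponent \<open>1\<close>.\<close>
  define v where "v n r = (if r = 0 then w n s else w' n t)" for n and r :: real
  have v: "cover_M_at v X T Z 0 N \<epsilon> = cover_M_at w X T Z s N \<epsilon>"
    "cover_M_at v X T Z 1 N \<epsilon> = cover_M_at w' X T Z t N \<epsilon>" for N
    by (simp_all add: cover_M_at_def v_def)
  have "cover_M_at w X T Z s N \<epsilon> = 0" for N
    using incseq_le[OF cover_M_at_incseq cover_M_at_tendsto, of w X T Z s N \<epsilon>] zero by simp
  moreover have "cover_M_at v X T Z 1 N \<epsilon> \<le> ennreal c * cover_M_at v X T Z 0 N \<epsilon>" for N
    using c w pos by (intro cover_M_at_scale) (auto simp: v_def)
  ultimately have "cover_M_at w' X T Z t N \<epsilon> = 0" for N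
    by (simp add: v)
  then show ?thesis
    using LIMSEQ_unique[OF cover_M_at_tendsto[of w' X T Z t \<epsilon>]] by simp
qed

lemma slow_entropy_at_infinite_or_bowen_entropy_at_zero:
  "cover_entropy_at slow_weight X T Z \<epsilon> = \<infinity> \<or> cover_entropy_at bowen_weight X T Z \<epsilon> = 0"
proof (cases "\<exists>s\<ge>0. cover_M slow_weight X T Z s \<epsilon> = 0")
  case True
  then obtain s where s: "s \<ge> 0" "cover_M slow_weight X T Z s \<epsilon> = 0"
    by blast
  have bound: "cover_entropy_at bowen_weight X T Z \<epsilon> \<le> ennreal t" if t: "t > 0" for t
  proof -
    obtain c where c: "c > 0" "\<And>n. n \<ge> 1 \<Longrightarrow> bowen_weight n t \<le> c * slow_weight n s"
      using bowen_weight_le_slow_weight s(1) t by blast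
    have "cover_M bowen_weight X T Z t \<epsilon> = 0"
    proof (rule cover_M_eq_0_weight_mono[OF c(1)])
      show "bowen_weight n t \<le> c * slow_weight n s" if "n \<ge> 1" for n
        using c(2) that .
      show "slow_weight n s \<ge> 0" for n
        by (simp add: slow_weight_def)
    qed (fact s(2))
    then show ?thesis
      unfolding cover_entropy_at_def using t by (intro Inf_lower CollectI exI[of _ t]) simp
  qed
  have "cover_entropy_at bowen_weight X T Z \<epsilon> \<le> 0"
    by (rule ennreal_le_epsilon) (simp add: bound)
  then show ?thesis by simp
next
  case False
  then have empty: "{ennreal s | s. s \<ge> 0 \<and> cover_M slow_weight X T Z s \<epsilon> = 0} = {}"
    by blast
  show ?thesis
    unfolding cover_entropy_at_def[of slow_weight] empty by simp
qed

lemma cover_entropy_at_le_cover_entropy: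
  assumes "\<epsilon> > 0"
  shows "cover_entropy_at w X T Z \<epsilon> \<le> cover_entropy w X T Z"
proof (rule tendsto_lowerbound[OF cover_entropy_at_tendsto])
  show "\<forall>\<^sub>F \<delta> in at_right 0. cover_entropy_at w X T Z \<epsilon> \<le> cover_entropy_at w X T Z \<delta>"
    using assms cover_entropy_at_antimono less_imp_le
    unfolding eventually_at_right_field by blast
qed simp

theorem proposition2p2:
  fixes X Z :: "'a::metric_space set" and T :: "'a \<Rightarrow> 'a"
  assumes "compact X"
    and "continuous_on X T"
    and "T ` X \<subseteq> X"
    and "Z \<subseteq> X"
  shows "top_slow_entropy X T Z \<ge> bowen_top_entropy X T Z \<and>
    (bowen_top_entropy X T Z > 0 \<longrightarrow> top_slow_entropy X T Z = \<infinity>)"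
proof -
  have infinite: "top_slow_entropy X T Z = \<infinity>" if "bowen_top_entropy X T Z > 0"
  proof -
    have "\<forall>\<^sub>F \<epsilon> in at_right 0. 0 < cover_entropy_at bowen_weight X T Z \<epsilon>"
      using that order_tendstoD(1)[OF cover_entropy_at_tendsto]
      unfolding bowen_top_entropy_def by blast
    then obtain b :: real where b: "b > 0"
      "\<And>\<epsilon>. \<lbrakk>0 < \<epsilon>; \<epsilon> < b\<rbrakk> \<Longrightarrow> 0 < cover_entropy_at bowen_weight X T Z \<epsilon>"
      unfolding eventually_at_right_field by blast
    then have "0 < cover_entropy_at bowen_weight X T Z (b / 2)"
      by simp
    then have "cover_entropy_at slow_weight X T Z (b / 2) = \<infinity>"
      using slow_entropy_at_infinite_or_bowen_entropy_at_zero[of X T Z "b / 2"] by auto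
    moreover have "cover_entropy_at slow_weight X T Z (b / 2) \<le> cover_entropy slow_weight X T Z"
      using b(1) by (intro cover_entropy_at_le_cover_entropy) simp
    ultimately show ?thesis
      by (simp add: top_slow_entropy_def top_unique)
  qed
  then have "bowen_top_entropy X T Z \<le> top_slow_entropy X T Z"
    by (cases "bowen_top_entropy X T Z = 0") (auto simp: zero_less_iff_neq_zero)
  with infinite show ?thesis by blast
qed

end
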